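(* Let $m,n$ be integers with $4\le m\le n-3$ (so that $S=\{2,m,n-1\}$ is $n$-admissible), and define $p(\{2,m,n-1\};n)$ by $\#P(\{2,m,n-1\};n)=p(\{2,m,n-1\};n)\,2^{n-4}$. Then $$2p(\{2,m,n-1\};n)=(m-3)(n-m-2)\binom{n-1}{m-1}+(n-1)\Big[(m-3)\binom{n-4}{m-1}+(m-2)\binom{n-4}{m-2}+(n-m-1)\binom{n-4}{m-3}+(n-m-2)\binom{n-4}{m-4}-2\binom{n-4}{1}\Big].$$ Moreover, for fixed $n$, the sequence $p(\{2,m,n-1\};n)$ for $4\le m\le n-3$ is symmetric and unimodal, and attains its maximum only at $m=\lfloor (n+1)/2\rfloor$ and at $m=\lceil (n+1)/2\rceil$.
   Context: For a permutation $\pi=a_1\ldots a_n$ of $\{1,\ldots,n\}$, an index $i$ is a peak if $a_{i-1}<a_i>a_{i+1}$. $P(S;n)$ is the set of permutations of $\{1,\dots,n\}$ whose set of peaks is exactly $S$. *)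

theory Defs
  imports Complex_Main "HOL-Combinatorics.Permutations"
begin

text \<open>A permutation \<open>a\<^sub>1 \<dots> a\<^sub>n\<close> of \<open>{1..n}\<close> is a function with
  \<open>\<pi> permutes {1..n}\<close> and \<open>a\<^sub>i = \<pi> i\<close>. As \<open>\<pi>\<close> is also defined (as the identity) outside
  \<open>{1..n}\<close>, peaks must be restricted explicitly to the indices having both neighbours
  in \<open>{1..n}\<close>.\<close>

definition peak_set :: "nat \<Rightarrow> (nat \<Rightarrow> nat) \<Rightarrow> nat set" where
  "peak_set n \<pi> = {i. 1 < i \<and> i < n \<and> \<pi> (i - 1) < \<pi> i \<and> \<pi> i > \<pi> (i + 1)}"

definition peak_perms :: "nat set \<Rightarrow> nat \<Rightarrow> (nat \<Rightarrow> nat) set" where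
  "peak_perms S n = {\<pi>. \<pi> permutes {1..n} \<and> peak_set n \<pi> = S}"

text \<open>\<open>p({2,m,n-1};n)\<close>, the solution of \<open>#P({2,m,n-1};n) = p({2,m,n-1};n) * 2^(n-4)\<close>. It is
  real-valued, so integrality is not built in.\<close>

definition peak_p :: "nat \<Rightarrow> nat \<Rightarrow> real" where
  "peak_p m n = real (card (peak_perms {2, m, n - 1} n)) / 2 ^ (n - 4)"

definition unimodal_on :: "nat set \<Rightarrow> (nat \<Rightarrow> real) \<Rightarrow> bool" where
  "unimodal_on A f \<longleftrightarrow>
     (\<exists>k\<in>A. (\<forall>i\<in>A. \<forall>j\<in>A. i \<le> j \<and> j \<le> k \<longrightarrow> f i \<le> f j) \<and>
            (\<forall>i\<in>A. \<forall>j\<in>A. k \<le> i \<and> i \<le> j \<longrightarrow> f j \<le> f i))"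

end

theory Submission
  imports Defs "HOL-Combinatorics.Multiset_Permutations"
begin

text \<open>
  Splitting a permutation at its largest entry leaves two arbitrary shorter words, so peak counts
  obey a recursion on the position of the maximum, which is an end of the word or one of the
  prescribed peaks. For \<open>S = {2, m, n - 1}\<close> an end is impossible; the position \<open>m\<close> yields the product
  term, and the positions \<open>2\<close> and \<open>n - 1\<close> yield two mirror-image counts with peak sets of the form
  \<open>{2, l}\<close>, which are evaluated by the same recursion.

  Reversal gives the symmetry. For unimodality, the formula collapses, with \<open>k = n - 1\<close> and
  \<open>a = m - 1\<close>, to
  \<open>(k - 1) * 2p = (k choose a) * (2(k + 1)a(k - a) - 4(k - 1)\<^sup>2) - 2k(k - 1)(k - 3)\<close>,
  where both factors of the product are positive and increase with \<open>a \<le> k/2\<close>, the first one strictly.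
\<close>

section \<open>Peaks of lists\<close>

text \<open>List positions start at \<open>0\<close>, so these indices are one less than those of \<^const>\<open>peak_set\<close>.\<close>

definition peak_indices :: "'a::linorder list \<Rightarrow> nat set" where
  "peak_indices xs =
     {i. 0 < i \<and> Suc i < length xs \<and> xs ! (i - 1) < xs ! i \<and> xs ! Suc i < xs ! i}"

text \<open>Arbitrary value sets are allowed because the words before and after a maximum use
  arbitrary complementary sets of the remaining values.\<close>

definition peak_lists :: "nat set \<Rightarrow> 'a::linorder set \<Rightarrow> 'a list set" where
  "peak_lists S A = {xs \<in> permutations_of_set A. peak_indices xs = S}"

lemma peak_lists_iff:
  "xs \<in> peak_lists S A \<longleftrightarrow> set xs = A \<and> distinct xs \<and> peak_indices xs = S"
  by (auto simp: peak_lists_def permutations_of_set_def)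

lemma finite_peak_lists: "finite (peak_lists S A)"
  unfolding peak_lists_def by simp

lemma peak_indices_bound: "i \<in> peak_indices xs \<Longrightarrow> 0 < i \<and> Suc i < length xs"
  by (simp add: peak_indices_def)

text \<open>\<open>M\<close> exceeds its neighbours, so it is a peak unless it stands at an end, and
  the entries next to it are never peaks. Every other entry sees only its own side.\<close>

lemma peak_indices_append_Max_Cons:
  assumes less: "\<forall>x\<in>set xs \<union> set ys. x < M"
  shows "i \<in> peak_indices (xs @ M # ys) \<longleftrightarrow>
    i \<in> peak_indices xs \<or> (i = length xs \<and> xs \<noteq> [] \<and> ys \<noteq> []) \<or>
    (i > length xs \<and> i - Suc (length xs) \<in> peak_indices ys)"
proof -
  have lx: "xs ! j < M" if "j < length xs" for j
    using less that by simp
  have ly: "ys ! j < M" if "j < length ys" for j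
    using less that by simp
  consider "Suc i < length xs" | "Suc i = length xs" | "i = length xs"
    | "i = Suc (length xs)" | d where "i = length xs + Suc (Suc d)"
  proof -
    have "Suc i < length xs \<or> Suc i = length xs \<or> i = length xs \<or> i = Suc (length xs) \<or>
      i = length xs + Suc (Suc (i - length xs - 2))" by arith
    then show thesis using that by blast
  qed
  then show ?thesis
  proof cases
    case 1
    then show ?thesis by (auto simp: peak_indices_def nth_append)
  next
    case 2
    then have "xs ! i < M" using lx by simp
    with 2 show ?thesis by (auto simp: peak_indices_def nth_append)
  next
    case 3
    then have "xs \<noteq> [] \<Longrightarrow> xs ! (i - 1) < M" "ys \<noteq> [] \<Longrightarrow> ys ! 0 < M"
      using lx ly by simp_all
    with 3 show ?thesis
      by (cases "xs = []"; cases "ys = []") (auto simp: peak_indices_def nth_append)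
  next
    case 4
    have "ys \<noteq> [] \<Longrightarrow> \<not> M < ys ! 0" using ly[of 0] by auto
    with 4 show ?thesis by (cases "ys = []") (auto simp: peak_indices_def nth_append)
  next
    case (5 d)
    then show ?thesis by (auto simp: peak_indices_def nth_append)
  qed
qed

text \<open>Separates the condition on the whole word into one on the position of \<open>M\<close>
  and one on each side; this independence makes the counts of the two sides multiply.\<close>

lemma peak_indices_append_Max_Cons_eq_iff:
  assumes "\<forall>x\<in>set xs \<union> set ys. x < M"
  shows "peak_indices (xs @ M # ys) = S \<longleftrightarrow>
    (length xs \<in> S \<longleftrightarrow> xs \<noteq> [] \<and> ys \<noteq> []) \<and>
    peak_indices xs = S \<inter> {..<length xs} \<and>
    peak_indices ys = {i. i + length xs + 1 \<in> S}"
    (is "?L \<longleftrightarrow> ?R")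
proof
  note mem = peak_indices_append_Max_Cons[of xs ys M, OF assms]
  have bd: "i < length xs" if "i \<in> peak_indices xs" for i
    using peak_indices_bound[OF that] by simp
  show ?R if ?L
    unfolding that[symmetric] by (auto simp: mem dest: bd peak_indices_bound)
  show ?L if R: ?R
  proof (rule set_eqI)
    fix i
    consider "i < length xs" | "i = length xs" | "i > length xs" by linarith
    then show "i \<in> peak_indices (xs @ M # ys) \<longleftrightarrow> i \<in> S"
    proof cases
      case 1
      then show ?thesis using R by (simp add: mem)
    next
      case 2
      then show ?thesis using R by (simp add: mem)
    next
      case 3
      then show ?thesis using R by (simp add: mem)
    qed
  qed
qed

section \<open>The recursion on the position of the maximum\<close>

text \<open>The summation variable \<open>j\<close> is the number of entries in front of the maximum of \<open>Suc k\<close> entries.\<close>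

fun peak_count :: "nat set \<Rightarrow> nat \<Rightarrow> nat" where
  "peak_count S 0 = (if S = {} then 1 else 0)"
| "peak_count S (Suc k) = (\<Sum>j\<le>k. if j \<in> S \<longleftrightarrow> 0 < j \<and> j < k
     then (k choose j) * (peak_count (S \<inter> {..<j}) j * peak_count {i. i + j + 1 \<in> S} (k - j))
     else 0)"

text \<open>\<open>C\<close> is the set of values in front of \<open>M\<close>, so
  \<open>card C\<close> is the position of \<open>M\<close>.\<close>

lemma peak_lists_insert_Max:
  assumes fin: "finite B" and less: "\<forall>x\<in>B. x < M"
  shows "peak_lists S (insert M B) =
    (\<Union>C\<in>{C. C \<subseteq> B \<and> (card C \<in> S \<longleftrightarrow> 0 < card C \<and> card C < card B)}.
      (\<lambda>(xs, ys). xs @ M # ys) `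
        (peak_lists (S \<inter> {..<card C}) C \<times> peak_lists {i. i + card C + 1 \<in> S} (B - C)))"
    (is "?L = ?R")
proof -
  have nM: "M \<notin> B" using less by blast
  \<comment> \<open>For a given split, the only candidate for \<open>C\<close> is
    \<open>set xs\<close>.\<close>
  have key: "xs @ M # ys \<in> peak_lists S (insert M B) \<longleftrightarrow>
      set xs \<subseteq> B \<and> (card (set xs) \<in> S \<longleftrightarrow> 0 < card (set xs) \<and> card (set xs) < card B) \<and>
      xs \<in> peak_lists (S \<inter> {..<card (set xs)}) (set xs) \<and>
      ys \<in> peak_lists {i. i + card (set xs) + 1 \<in> S} (B - set xs)" (is "?l \<longleftrightarrow> ?r") for xs ys
  proof -
    have split: "set (xs @ M # ys) = insert M B \<and> distinct (xs @ M # ys) \<longleftrightarrow>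
        set xs \<subseteq> B \<and> set ys = B - set xs \<and> distinct xs \<and> distinct ys"
      using nM by auto
    show ?thesis
    proof (cases "set xs \<subseteq> B \<and> set ys = B - set xs \<and> distinct xs \<and> distinct ys")
      case True
      then have lt: "\<forall>x\<in>set xs \<union> set ys. x < M" using less by auto
      have c: "card (set xs) = length xs" using True distinct_card by blast
      have "ys \<noteq> [] \<longleftrightarrow> card (set xs) < card B"
      proof -
        have "ys \<noteq> [] \<longleftrightarrow> set xs \<noteq> B"
          using True by (metis Diff_cancel Diff_eq_empty_iff set_empty subset_antisym)
        also have "\<dots> \<longleftrightarrow> card (set xs) < card B"
          using True fin by (metis less_irrefl psubsetI psubset_card_mono)
        finally show ?thesis .
      qed
      moreover have "?l \<longleftrightarrow> peak_indices (xs @ M # ys) = S"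
        using split True unfolding peak_lists_iff by blast
      ultimately show ?thesis
        using True peak_indices_append_Max_Cons_eq_iff[of xs ys M S, OF lt]
        by (simp add: peak_lists_iff c)
    next
      case False
      then have "\<not> ?l" using split unfolding peak_lists_iff by blast
      moreover have "\<not> ?r" using False unfolding peak_lists_iff by blast
      ultimately show ?thesis by blast
    qed
  qed
  show ?thesis
  proof (rule set_eqI)
    fix zs
    show "zs \<in> ?L \<longleftrightarrow> zs \<in> ?R"
    proof
      assume zs: "zs \<in> ?L"
      then have "M \<in> set zs" by (simp add: peak_lists_iff)
      then obtain xs ys where eq: "zs = xs @ M # ys" by (meson split_list)
      show "zs \<in> ?R"
        using zs unfolding eq key
        by (intro UN_I[of "set xs"] image_eqI[of _ _ "(xs, ys)"]) simp_all
    next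
      assume "zs \<in> ?R"
      then obtain C xs ys where C: "C \<subseteq> B" "card C \<in> S \<longleftrightarrow> 0 < card C \<and> card C < card B"
        and xs: "xs \<in> peak_lists (S \<inter> {..<card C}) C"
        and ys: "ys \<in> peak_lists {i. i + card C + 1 \<in> S} (B - C)" and eq: "zs = xs @ M # ys"
        by auto
      have "C = set xs" using xs by (simp add: peak_lists_iff)
      with C xs ys show "zs \<in> ?L" unfolding eq key by blast
    qed
  qed
qed

text \<open>The first occurrence of \<open>M\<close> determines the split. This gives injectivity
  for a fixed \<open>C\<close> and disjointness for different ones.\<close>

lemma append_Cons_notin_eqD:
  assumes "M \<notin> set xs" "M \<notin> set xs'" "xs @ M # ys = xs' @ M # ys'"
  shows "xs = xs' \<and> ys = ys'"
  using assms
proof (induction xs arbitrary: xs')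
  case Nil
  then show ?case by (cases xs') auto
next
  case (Cons x xs)
  then show ?case by (cases xs') auto
qed

text \<open>Grouping the subsets by size produces the binomial coefficients of
  \<open>peak_count\<close>.\<close>

lemma sum_Pow_card:
  fixes f :: "nat \<Rightarrow> nat"
  assumes "finite B"
  shows "(\<Sum>C\<in>Pow B. f (card C)) = (\<Sum>j\<le>card B. (card B choose j) * f j)"
proof -
  have "(\<Sum>C\<in>Pow B. f (card C)) = (\<Sum>j\<le>card B. \<Sum>C\<in>{C\<in>Pow B. card C = j}. f (card C))"
    using assms by (intro sum.group[symmetric]) (auto intro: card_mono)
  also have "\<dots> = (\<Sum>j\<le>card B. (card B choose j) * f j)"
  proof (rule sum.cong)
    fix j
    have "(\<Sum>C\<in>{C\<in>Pow B. card C = j}. f (card C)) = (\<Sum>C\<in>{C. C \<subseteq> B \<and> card C = j}. f j)"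
      by (intro sum.cong) auto
    also have "\<dots> = (card B choose j) * f j"
      using n_subsets[OF assms] by simp
    finally show "(\<Sum>C\<in>{C\<in>Pow B. card C = j}. f (card C)) = (card B choose j) * f j" .
  qed simp
  finally show ?thesis .
qed

text \<open>Only the relative order of the entries matters. The induction is on
  \<open>card A\<close> for all \<open>S\<close> at once, since the two sides of the maximum have
  smaller value sets and other peak sets.\<close>

lemma card_peak_lists:
  assumes "finite A"
  shows "card (peak_lists S A) = peak_count S (card A)"
  using assms
proof (induction "card A" arbitrary: A S rule: less_induct)
  case less
  show ?case
  proof (cases "A = {}")
    case True
    have "peak_lists S {} = (if S = {} then {[]} else {} :: 'a list set)"
      by (auto simp: peak_lists_iff peak_indices_def)
    then show ?thesis using True by simp
  next
    case False
    define M where "M = Max A"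
    define B where "B = A - {M}"
    have "M \<in> A" using False less.prems by (simp add: M_def)
    then have A: "A = insert M B" by (auto simp: B_def)
    have fin: "finite B" using less.prems by (simp add: B_def)
    have lt: "\<forall>x\<in>B. x < M"
      using less.prems by (auto simp: B_def M_def less_le)
    have nM: "M \<notin> B" by (simp add: B_def)
    have cA: "card A = Suc (card B)" using A fin nM by simp
    let ?T = "\<lambda>C. (\<lambda>(xs, ys). xs @ M # ys) `
        (peak_lists (S \<inter> {..<card C}) C \<times> peak_lists {i. i + card C + 1 \<in> S} (B - C))"
    let ?I = "{C. C \<subseteq> B \<and> (card C \<in> S \<longleftrightarrow> 0 < card C \<and> card C < card B)}"
    let ?g = "\<lambda>j. peak_count (S \<inter> {..<j}) j * peak_count {i. i + j + 1 \<in> S} (card B - j)"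
    let ?f = "\<lambda>j. if j \<in> S \<longleftrightarrow> 0 < j \<and> j < card B then ?g j else 0"
    have cardT: "card (?T C) = ?g (card C)" if "C \<subseteq> B" for C
    proof -
      have "finite C" using that fin finite_subset by blast
      moreover have "card C < card A" "card (B - C) < card A"
        using that fin cA by (simp_all add: card_mono less_Suc_eq_le)
      moreover have "inj_on (\<lambda>(xs, ys). xs @ M # ys)
        (peak_lists (S \<inter> {..<card C}) C \<times> peak_lists {i. i + card C + 1 \<in> S} (B - C))"
      proof (rule inj_onI, clarify)
        fix xs ys xs' ys'
        assume "xs \<in> peak_lists (S \<inter> {..<card C}) C" "xs' \<in> peak_lists (S \<inter> {..<card C}) C"
          and eq: "xs @ M # ys = xs' @ M # ys'"
        then have "M \<notin> set xs" "M \<notin> set xs'" using that nM by (auto simp: peak_lists_iff)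
        then show "xs = xs' \<and> ys = ys'" using eq by (rule append_Cons_notin_eqD)
      qed
      ultimately show ?thesis
        using less.hyps[of C] less.hyps[of "B - C"] fin that
        by (simp add: card_image card_cartesian_product card_Diff_subset)
    qed
    have "card (peak_lists S A) = card (\<Union>C\<in>?I. ?T C)"
      unfolding A by (subst peak_lists_insert_Max[OF fin lt]) simp_all
    also have "\<dots> = (\<Sum>C\<in>?I. card (?T C))"
    proof (rule card_UN_disjoint)
      show "finite ?I" using fin by (rule rev_finite_subset[OF finite_Pow_iff[THEN iffD2]]) auto
      show "\<forall>C\<in>?I. finite (?T C)" by (simp add: finite_peak_lists)
      show "\<forall>C\<in>?I. \<forall>D\<in>?I. C \<noteq> D \<longrightarrow> ?T C \<inter> ?T D = {}"
      proof (intro ballI impI, rule ccontr)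
        fix C D
        assume CD: "C \<in> ?I" "D \<in> ?I" "C \<noteq> D" "?T C \<inter> ?T D \<noteq> {}"
        then obtain zs where zs: "zs \<in> ?T C" "zs \<in> ?T D" by blast
        from zs(1) obtain xs ys where "set xs = C" "zs = xs @ M # ys"
          by (auto simp: peak_lists_iff)
        moreover from zs(2) obtain xs' ys' where "set xs' = D" "zs = xs' @ M # ys'"
          by (auto simp: peak_lists_iff)
        moreover have "M \<notin> C" "M \<notin> D" using CD nM by auto
        ultimately show False using append_Cons_notin_eqD[of M xs xs' ys ys'] CD(3) by simp
      qed
    qed
    also have "\<dots> = (\<Sum>C\<in>?I. ?g (card C))" by (intro sum.cong refl cardT) simp
    \<comment> \<open>Inadmissible sets enter with value 0, so the sum runs over the whole power set
      and can be grouped by size.\<close>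
    also have "\<dots> = (\<Sum>C\<in>Pow B. ?f (card C))"
      using fin by (intro sum.mono_neutral_cong_left) auto
    also have "\<dots> = (\<Sum>j\<le>card B. (card B choose j) * ?f j)" using fin by (rule sum_Pow_card)
    also have "\<dots> = peak_count S (card A)"
      unfolding cA peak_count.simps by (simp only: if_distrib[of "(*) _"] mult_0_right)
    finally show ?thesis .
  qed
qed

declare peak_count.simps [simp del]

section \<open>Reversal, vanishing counts and the working form of the recursion\<close>

lemma peak_indices_rev:
  "peak_indices (rev xs) = {i. i < length xs \<and> length xs - Suc i \<in> peak_indices xs}"
proof -
  have "i \<in> peak_indices (rev xs) \<longleftrightarrow> i < length xs \<and> length xs - Suc i \<in> peak_indices xs" for i
  proof (cases "0 < i \<and> Suc i < length xs")
    case True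
    then have "length xs - i = Suc (length xs - Suc i)"
      "length xs - Suc (i - 1) = Suc (length xs - Suc i)"
      "length xs - Suc (Suc i) = length xs - Suc i - 1" by arith+
    with True show ?thesis by (auto simp: peak_indices_def rev_nth)
  next
    case False
    then show ?thesis by (auto simp: peak_indices_def)
  qed
  then show ?thesis by blast
qed

text \<open>Reversal of words is an involution; the bound on \<open>S\<close> makes reflecting
  \<open>S\<close> twice return \<open>S\<close>.\<close>

lemma peak_count_rev:
  assumes "S \<subseteq> {..<k}"
  shows "peak_count {i. i < k \<and> k - Suc i \<in> S} k = peak_count S k"
proof -
  let ?R = "{i. i < k \<and> k - Suc i \<in> S}"
  have "bij_betw rev (peak_lists S {..<k}) (peak_lists ?R {..<k})"
  proof (rule bij_betwI[where g = rev])
    show "rev \<in> peak_lists S {..<k} \<rightarrow> peak_lists ?R {..<k}"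
      using distinct_card by (fastforce simp: peak_lists_iff peak_indices_rev)
    have "{i. i < k \<and> k - Suc i \<in> ?R} = S" using assms by auto
    then show "rev \<in> peak_lists ?R {..<k} \<rightarrow> peak_lists S {..<k}"
      using distinct_card by (fastforce simp: peak_lists_iff peak_indices_rev)
  qed auto
  then show ?thesis
    using bij_betw_same_card card_peak_lists[of "{..<k}"] by fastforce
qed

text \<open>A peak needs a neighbour on each side. Below, this discards end positions of the
  maximum.\<close>

lemma peak_count_eq_0:
  assumes "i \<in> S" "i = 0 \<or> k \<le> Suc i"
  shows "peak_count S k = 0"
proof -
  have "xs \<notin> peak_lists S {..<k}" for xs
  proof
    assume xs: "xs \<in> peak_lists S {..<k}"
    then have "length xs = k" using distinct_card by (fastforce simp: peak_lists_iff)
    moreover have "i \<in> peak_indices xs" using xs assms(1) by (simp add: peak_lists_iff)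
    ultimately show False using peak_indices_bound assms(2) by fastforce
  qed
  then have "peak_lists S {..<k} = {}" by blast
  then show ?thesis using card_peak_lists[of "{..<k}" S] by simp
qed

text \<open>An interior maximum is always a peak, so the maximum stands at a position in
  \<open>S\<close> or at an end. The first two summands belong to the front and to the back, which
  \<open>0 < k\<close> keeps distinct.\<close>

lemma peak_count_Suc:
  assumes "0 < k" "S \<subseteq> {0<..<k}"
  shows "peak_count S (Suc k) = peak_count {i. Suc i \<in> S} k + peak_count S k +
    (\<Sum>j\<in>S. (k choose j) * (peak_count (S \<inter> {..<j}) j * peak_count {i. i + j + 1 \<in> S} (k - j)))"
    (is "_ = _ + _ + sum ?f S")
proof -
  have fin: "finite S" using assms(2) finite_subset by blast
  have z: "0 \<notin> S" "k \<notin> S" using assms(2) by auto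
  have "peak_count S (Suc k) =
    (\<Sum>j\<le>k. if j \<in> S \<longleftrightarrow> 0 < j \<and> j < k then ?f j else 0)" by (simp add: peak_count.simps)
  also have "\<dots> = sum ?f (insert 0 (insert k S))"
    using assms by (intro sum.mono_neutral_cong_right) auto
  also have "\<dots> = ?f 0 + ?f k + sum ?f S"
    using fin z assms(1) by simp
  also have "?f 0 = peak_count {i. Suc i \<in> S} k" by (simp add: peak_count.simps)
  also have "?f k = peak_count S k"
  proof -
    have "S \<inter> {..<k} = S" "{i. i + k + 1 \<in> S} = {}" using assms(2) by auto
    then show ?thesis by (simp add: peak_count.simps)
  qed
  finally show ?thesis .
qed

section \<open>Counts for small peak sets\<close>

text \<open>Without peaks the maximum must stand at an end, so each further entry doubles the
  count.\<close>

lemma peak_count_empty: "peak_count {} (Suc k) = 2 ^ k"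
proof (induction k)
  case 0
  then show ?case by (simp add: peak_count.simps)
next
  case (Suc k)
  then show ?case using peak_count_Suc[of "Suc k" "{}"] by simp
qed

text \<open>The end positions \<open>0\<close> and \<open>N - 1\<close>, where both sides vanish,
  are included because the recursion reaches them when the maximum stands at an end.\<close>

lemma peak_count_single:
  assumes "a < N" "2 \<le> N"
  shows "real (peak_count {a} N) = (real ((N - 1) choose a) - 1) * 2 ^ (N - 2)"
  using assms
proof (induction N arbitrary: a)
  case 0
  then show ?case by simp
next
  case (Suc k)
  show ?case
  proof (cases "a = 0 \<or> a = k")
    case True
    then have "peak_count {a} (Suc k) = 0" by (intro peak_count_eq_0[of a]) auto
    then show ?thesis using True by auto
  next
    case False
    \<comment> \<open>With the maximum at \<open>a\<close>, there are \<open>b + 1\<close> entries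
      before it and \<open>c + 1\<close> after it, with \<open>2 ^ b\<close> and
      \<open>2 ^ c\<close> peak-free arrangements.\<close>
    then obtain b where b: "a = Suc b" by (cases a) auto
    obtain c where c: "k = Suc (Suc (b + c))"
      using False Suc.prems b by (intro that[of "k - b - 2"]) auto
    have s: "{a} \<inter> {..<a} = {}" "{i. i + a + 1 \<in> {a}} = {}" "{i. Suc i = a} = {b}"
      using b by auto
    have k: "k - a = Suc c" using b c by simp
    have rec: "peak_count {a} (Suc k) =
        peak_count {b} k + peak_count {a} k + (k choose a) * (2 ^ b * 2 ^ c)"
      using False Suc.prems peak_count_empty[of b] peak_count_empty[of c]
      by (subst peak_count_Suc) (auto simp: s k b[symmetric])
    \<comment> \<open>By Pascal's rule the two smaller counts together supply a second copy of
      \<open>k choose a\<close>.\<close>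
    have "real (k choose a) = real ((k - 1) choose a) + real ((k - 1) choose b)"
      unfolding c b by simp
    moreover have "(2::real) ^ b * 2 ^ c = 2 ^ (k - 2)" "(2::real) ^ (Suc k - 2) = 2 * 2 ^ (k - 2)"
      unfolding c by (simp_all add: power_add)
    ultimately show ?thesis
      using Suc.IH[of a] Suc.IH[of b] False Suc.prems b c unfolding rec
      by (simp add: algebra_simps power_add)
  qed
qed

lemma peak_count_1:
  assumes "3 \<le> a"
  shows "real (peak_count {1} a) = (real a - 2) * 2 ^ (a - 2)"
  using peak_count_single[of 1 a] assms by (simp add: of_nat_diff)

text \<open>The maximum cannot come first, so it stands at \<open>1\<close>, at \<open>a\<close> or
  at the back. Only the last case keeps the peak set, hence induction on \<open>N\<close> with
  \<open>a\<close> fixed, starting from \<open>a = N - 1\<close>, where both sides vanish.\<close>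

lemma peak_count_1_single:
  assumes "3 \<le> a" "a < N"
  shows "real (peak_count {1, a} N) =
    ((real a - 2) * real ((N - 2) choose a) + (real a - 1) * real ((N - 2) choose (a - 1))
      - (real N - 2)) * 2 ^ (N - 3)"
  using assms
proof (induction N)
  case 0
  then show ?case by simp
next
  case (Suc k)
  show ?case
  proof (cases "a = k")
    case True
    then have "peak_count {1, a} (Suc k) = 0" by (intro peak_count_eq_0[of a]) auto
    then show ?thesis using True Suc.prems by simp
  next
    case False
    then have ak: "a < k" using Suc.prems by simp
    \<comment> \<open>The substitution removes truncated subtraction; \<open>c + 1\<close> entries
      follow a maximum at \<open>a\<close>.\<close>
    obtain b where b: "a = b + 3" using Suc.prems by (intro that[of "a - 3"]) auto
    obtain c where c: "k = b + c + 4" using ak b by (intro that[of "k - b - 4"]) auto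
    have s: "{1, a} \<inter> {..<1} = {}" "{1, a} \<inter> {..<a} = {1}"
      "{i. i + 1 + 1 \<in> {1, a}} = {b + 1}" "{i. i + a + 1 \<in> {1, a}} = {}"
      using b by auto
    \<comment> \<open>A maximum in front would leave a peak at position \<open>0\<close> of the
      rest.\<close>
    have z: "peak_count {i. Suc i \<in> {1, a}} k = 0"
      by (intro peak_count_eq_0[of 0]) auto
    have "peak_count {1, a} (Suc k) = peak_count {i. Suc i \<in> {1, a}} k + peak_count {1, a} k +
        (\<Sum>j\<in>{1, a}. (k choose j) *
          (peak_count ({1, a} \<inter> {..<j}) j * peak_count {i. i + j + 1 \<in> {1, a}} (k - j)))"
      using ak b by (intro peak_count_Suc) auto
    also have "\<dots> = peak_count {1, a} k +
        (k choose 1) * (peak_count ({1, a} \<inter> {..<1}) 1 * peak_count {i. i + 1 + 1 \<in> {1, a}} (k - 1)) +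
        (k choose a) * (peak_count ({1, a} \<inter> {..<a}) a * peak_count {i. i + a + 1 \<in> {1, a}} (k - a))"
      unfolding z using b by simp
    also have "\<dots> = peak_count {1, a} k + k * peak_count {b + 1} (k - 1) +
        (k choose a) * (peak_count {1} a * 2 ^ c)"
      unfolding s using b c peak_count_empty[of 0] peak_count_empty[of c] by simp
    finally have rec: "peak_count {1, a} (Suc k) = peak_count {1, a} k +
        k * peak_count {b + 1} (k - 1) + (k choose a) * (peak_count {1} a * 2 ^ c)" .
    \<comment> \<open>Adjacent entries of row \<open>k - 2\<close> of Pascal's triangle, in columns
      \<open>a\<close>, \<open>a - 1\<close>, \<open>a - 2\<close>; all other binomial coefficients
      are sums of these.\<close>
    define x y w where "x = real ((b + c + 2) choose (b + 3))"
      and "y = real ((b + c + 2) choose (b + 2))" and "w = real ((b + c + 2) choose (b + 1))"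
    define e where "e = (2::real) ^ (b + c + 1)"
    \<comment> \<open>The ratio of two adjacent entries, which Pascal's rule alone does not
      give.\<close>
    have "(b + 2) * ((b + c + 2) choose (b + 2)) = (c + 1) * ((b + c + 2) choose (b + 1))"
      using binomial_absorb_comp[of "b + c + 2" "b + 1"] binomial_absorption[of "b + 1" "b + c + 2"]
      by simp
    then have yw: "(real b + 2) * y = (real c + 1) * w"
      unfolding y_def w_def of_nat_eq_iff[where ?'a = real, symmetric] by (simp add: algebra_simps)
    have r1: "real (peak_count {1, a} k) =
        ((real b + 1) * x + (real b + 2) * y - (real b + real c + 2)) * e"
      using Suc.IH ak Suc.prems by (simp add: b c x_def y_def e_def add_ac)
    have r2: "real (peak_count {b + 1} (k - 1)) = (w - 1) * e"
      using peak_count_single[of "b + 1" "k - 1"] c by (simp add: w_def e_def)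
    have r3: "real (peak_count {1} a) * 2 ^ c = (real b + 1) * e"
      using peak_count_1[of a] b by (simp add: e_def power_add)
    have r4: "real (k choose a) = x + 2 * y + w"
      unfolding x_def y_def w_def b c by (simp add: numeral_eq_Suc)
    have r5: "real ((Suc k - 2) choose a) = x + y" "real ((Suc k - 2) choose (a - 1)) = y + w"
      unfolding x_def y_def w_def b c by (simp_all add: numeral_eq_Suc)
    have r6: "(2::real) ^ (Suc k - 3) = 2 * e"
      unfolding c e_def by simp
    have r7: "real a = real b + 3" "real k = real b + real c + 4"
      "real (Suc k) = real b + real c + 5" using b c by auto
    have "real (peak_count {1, a} (Suc k)) =
        ((real b + 1) * x + (real b + 2) * y - (real b + real c + 2)
          + (real b + real c + 4) * (w - 1) + (x + 2 * y + w) * (real b + 1)) * e"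
      unfolding rec of_nat_add[where ?'a = real] of_nat_mult of_nat_power of_nat_numeral r1 r2 r3 r4 r7
      by (simp add: algebra_simps)
    \<comment> \<open>The two sides differ by \<open>(c + 1) * w - (b + 2) * y\<close>, which is
      zero by \<open>yw\<close>.\<close>
    also have "(real b + 1) * x + (real b + 2) * y - (real b + real c + 2)
          + (real b + real c + 4) * (w - 1) + (x + 2 * y + w) * (real b + 1)
        = 2 * ((real b + 1) * (x + y) + (real b + 2) * (y + w) - (real b + real c + 3))"
      using yw by (simp add: algebra_simps)
    finally show ?thesis unfolding r5 r6 r7 by (simp add: algebra_simps)
  qed
qed

text \<open>The maximum stands at \<open>1\<close>, \<open>a\<close> or \<open>k - 1\<close>. For
  the first two, the word behind it has a peak next to its last entry, and reversal brings its peak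
  set into the form evaluated above.\<close>

lemma peak_count_1_single_penultimate:
  assumes "3 \<le> a" "a + 3 \<le> k"
  shows "peak_count {1, a, k - 1} (Suc k) = k * peak_count {1, k - a} (k - 1) +
    (k choose a) * (peak_count {1} a * peak_count {1} (k - a)) + k * peak_count {1, a} (k - 1)"
proof -
  let ?S = "{1, a, k - 1}"
  have s: "?S \<inter> {..<1} = {}" "?S \<inter> {..<a} = {1}" "?S \<inter> {..<k - 1} = {1, a}"
    "{i. i + 1 + 1 \<in> ?S} = {a - 2, k - 3}" "{i. i + a + 1 \<in> ?S} = {k - a - 2}"
    "{i. i + (k - 1) + 1 \<in> ?S} = {}"
    using assms by auto
  \<comment> \<open>A maximum in front leaves a peak at the first position of the rest, a maximum at
    the back one at the last.\<close>
  have z: "peak_count {i. Suc i \<in> ?S} k = 0" "peak_count ?S k = 0"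
    using assms by (intro peak_count_eq_0[of 0] peak_count_eq_0[of "k - 1"]; simp)+
  have r1: "peak_count {a - 2, k - 3} (k - 1) = peak_count {1, k - a} (k - 1)"
  proof -
    have "{i. i < k - 1 \<and> k - 1 - Suc i \<in> {1, k - a}} = {a - 2, k - 3}" using assms by auto
    moreover have "{1, k - a} \<subseteq> {..<k - 1}" using assms by auto
    ultimately show ?thesis using peak_count_rev[of "{1, k - a}" "k - 1"] by simp
  qed
  have r2: "peak_count {k - a - 2} (k - a) = peak_count {1} (k - a)"
  proof -
    have "{i. i < k - a \<and> k - a - Suc i \<in> {1}} = {k - a - 2}" using assms by auto
    moreover have "{1} \<subseteq> {..<k - a}" using assms by auto
    ultimately show ?thesis using peak_count_rev[of "{1}" "k - a"] by simp
  qed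
  have one: "peak_count {} 1 = 1" using peak_count_empty[of 0] by simp
  have "peak_count ?S (Suc k) = peak_count {i. Suc i \<in> ?S} k + peak_count ?S k +
    (\<Sum>j\<in>?S. (k choose j) *
      (peak_count (?S \<inter> {..<j}) j * peak_count {i. i + j + 1 \<in> ?S} (k - j)))"
    using assms by (intro peak_count_Suc) auto
  also have "\<dots> = (\<Sum>j\<in>?S. (k choose j) *
      (peak_count (?S \<inter> {..<j}) j * peak_count {i. i + j + 1 \<in> ?S} (k - j)))"
    unfolding z by simp
  also have "\<dots> =
    (k choose 1) * (peak_count (?S \<inter> {..<1}) 1 * peak_count {i. i + 1 + 1 \<in> ?S} (k - 1)) +
    (k choose a) * (peak_count (?S \<inter> {..<a}) a * peak_count {i. i + a + 1 \<in> ?S} (k - a)) +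
    (k choose (k - 1)) * (peak_count (?S \<inter> {..<k - 1}) (k - 1)
      * peak_count {i. i + (k - 1) + 1 \<in> ?S} (k - (k - 1)))"
    using assms by simp
  also have "\<dots> = k * peak_count {1, k - a} (k - 1) +
    (k choose a) * (peak_count {1} a * peak_count {1} (k - a)) + k * peak_count {1, a} (k - 1)"
  proof -
    have "k - (k - 1) = 1" "k choose (k - 1) = k"
      using assms binomial_symmetric[of "k - 1" k] by simp_all
    then show ?thesis unfolding s r1 r2 by (simp add: one[simplified])
  qed
  finally show ?thesis .
qed

section \<open>From permutations to words\<close>

lemma card_peak_perms:
  "card (peak_perms S n) = (if 0 \<in> S then 0 else peak_count {i. Suc i \<in> S} n)"
\<comment> \<open>The shifted set \<open>{i. Suc i \<in> S}\<close> forgets whether \<open>0\<close>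
  is in \<open>S\<close>, so this case is treated separately.\<close>
proof (cases "0 \<in> S")
  case True
  then have "peak_perms S n = {}" by (auto simp: peak_perms_def peak_set_def)
  then show ?thesis using True by simp
next
  case False
  let ?l = "\<lambda>\<pi>. map \<pi> [1..<Suc n]"
  \<comment> \<open>The inverse of one-line notation; outside \<open>{1..n}\<close> it must be the
    identity to satisfy \<open>permutes\<close>.\<close>
  let ?p = "\<lambda>xs i. if i \<in> {1..n} then xs ! (i - 1) else i"
  have ln: "length xs = n" if "set xs = {1..n}" "distinct xs" for xs :: "nat list"
    using that distinct_card[of xs] by simp
  have pk: "peak_set n \<pi> = S \<longleftrightarrow> peak_indices (?l \<pi>) = {i. Suc i \<in> S}" for \<pi>
  proof -
    have "peak_indices (?l \<pi>) = {i. Suc i \<in> peak_set n \<pi>}"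
    proof (rule set_eqI)
      fix i
      show "i \<in> peak_indices (?l \<pi>) \<longleftrightarrow> i \<in> {i. Suc i \<in> peak_set n \<pi>}"
        by (cases i) (auto simp: peak_indices_def peak_set_def nth_append simp del: upt_Suc)
    qed
    moreover have "0 \<notin> peak_set n \<pi>" by (simp add: peak_set_def)
    ultimately show ?thesis using False
      by (metis (no_types, lifting) Collect_cong mem_Collect_eq not0_implies_Suc set_eqI)
  qed
  have "bij_betw ?l (peak_perms S n) (peak_lists {i. Suc i \<in> S} {1..n})"
  proof (rule bij_betwI[where g = ?p])
    show "?l \<in> peak_perms S n \<rightarrow> peak_lists {i. Suc i \<in> S} {1..n}"
    proof
      fix \<pi> assume p: "\<pi> \<in> peak_perms S n"
      then have per: "\<pi> permutes {1..n}" by (simp add: peak_perms_def)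
      then have "set (?l \<pi>) = {1..n}"
        using permutes_image[OF per] by (simp add: atLeastLessThanSuc_atLeastAtMost del: upt_Suc)
      moreover have "distinct (?l \<pi>)"
        using permutes_inj_on[OF per] by (simp add: distinct_map del: upt_Suc)
      ultimately show "?l \<pi> \<in> peak_lists {i. Suc i \<in> S} {1..n}"
        using p pk by (simp add: peak_lists_iff peak_perms_def del: upt_Suc)
    qed
    have lp: "?l (?p xs) = xs" if "set xs = {1..n}" "distinct xs" for xs
      using ln[OF that] by (intro nth_equalityI) (auto simp del: upt_Suc)
    show "?p \<in> peak_lists {i. Suc i \<in> S} {1..n} \<rightarrow> peak_perms S n"
    proof
      fix xs assume xs: "xs \<in> peak_lists {i. Suc i \<in> S} {1..n}"
      then have st: "set xs = {1..n}" and d: "distinct xs" by (auto simp: peak_lists_iff)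
      note len = ln[OF st d]
      have "bij_betw (?p xs) {1..n} {1..n}"
      proof (rule bij_betw_imageI)
        show "inj_on (?p xs) {1..n}"
          using d len by (auto intro!: inj_onI simp: nth_eq_iff_index_eq)
        have "?p xs ` {1..n} = set (?l (?p xs))"
          by (simp only: set_map set_upt atLeastLessThanSuc_atLeastAtMost)
        then show "?p xs ` {1..n} = {1..n}" unfolding lp[OF st d] st .
      qed
      then have "?p xs permutes {1..n}" by (rule bij_imp_permutes) auto
      then show "?p xs \<in> peak_perms S n"
        unfolding peak_perms_def using pk[of "?p xs"] xs unfolding lp[OF st d]
        by (simp add: peak_lists_iff)
    qed
    show "?l (?p xs) = xs" if "xs \<in> peak_lists {i. Suc i \<in> S} {1..n}" for xs
      using lp that by (auto simp only: peak_lists_iff)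
    show "?p (?l \<pi>) = \<pi>" if "\<pi> \<in> peak_perms S n" for \<pi>
      using that by (auto simp: peak_perms_def permutes_def fun_eq_iff simp del: upt_Suc)
  qed
  then show ?thesis
    using bij_betw_same_card card_peak_lists[of "{1..n}"] False by fastforce
qed

section \<open>The peak set \<open>{2, m, n - 1}\<close>\<close>

lemma peak_p_eq_peak_count:
  assumes "4 \<le> m" "m \<le> n - 3"
  shows "peak_p m n = real (peak_count {1, m - 1, n - 2} n) / 2 ^ (n - 4)"
proof -
  have "{i. Suc i \<in> {2, m, n - 1}} = {1, m - 1, n - 2}" using assms by auto
  moreover have "0 \<notin> {2, m, n - 1}" using assms by auto
  ultimately show ?thesis unfolding peak_p_def card_peak_perms by presburger
qed

text \<open>Reversal swaps the peaks \<open>2\<close> and \<open>n - 1\<close> and sends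
  \<open>m\<close> to \<open>n + 1 - m\<close>.\<close>

lemma peak_p_symmetric:
  assumes "4 \<le> m" "m \<le> n - 3"
  shows "peak_p (n + 1 - m) n = peak_p m n"
proof -
  have "{i. i < n \<and> n - Suc i \<in> {1, m - 1, n - 2}} = {1, n + 1 - m - 1, n - 2}"
    using assms by auto
  moreover have "{1, m - 1, n - 2} \<subseteq> {..<n}" using assms by auto
  ultimately have "peak_count {1, n + 1 - m - 1, n - 2} n = peak_count {1, m - 1, n - 2} n"
    using peak_count_rev[of "{1, m - 1, n - 2}" n] by simp
  then show ?thesis using assms by (simp add: peak_p_eq_peak_count)
qed

text \<open>The product comes from the maximum at \<open>m\<close>, columns \<open>m - 1\<close> and
  \<open>m - 2\<close> from the maximum at \<open>n - 1\<close>, and columns \<open>m - 3\<close>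
  and \<open>m - 4\<close> from the maximum at \<open>2\<close>.\<close>

lemma two_peak_p_eq:
  assumes "4 \<le> m" "m \<le> n - 3"
  shows "2 * peak_p m n =
    (real m - 3) * (real n - real m - 2) * real ((n - 1) choose (m - 1)) +
    (real n - 1) *
      ((real m - 3) * real ((n - 4) choose (m - 1)) +
       (real m - 2) * real ((n - 4) choose (m - 2)) +
       (real n - real m - 1) * real ((n - 4) choose (m - 3)) +
       (real n - real m - 2) * real ((n - 4) choose (m - 4)) -
       2 * real ((n - 4) choose 1))"
proof -
  \<comment> \<open>With \<open>b = m - 4\<close> and \<open>c = n - m - 3\<close>, the symmetry
    exchanges \<open>b\<close> and \<open>c\<close>.\<close>
  obtain b where b: "m = b + 4" using assms by (intro that[of "m - 4"]) auto
  obtain c where c: "n = b + c + 7" using assms b by (intro that[of "n - b - 7"]) auto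
  define k where "k = b + c + 6"
  define a where "a = b + 3"
  define e where "e = (2::real) ^ (b + c + 2)"
  have ka: "k - a = c + 3" "k - 1 = b + c + 5" by (simp_all add: k_def a_def)
  have eqs: "n = Suc k" "m - 1 = a" "n - 2 = k - 1" using b c by (simp_all add: k_def a_def)
  have r0: "peak_count {1, m - 1, n - 2} n = k * peak_count {1, k - a} (k - 1) +
    (k choose a) * (peak_count {1} a * peak_count {1} (k - a)) + k * peak_count {1, a} (k - 1)"
    using peak_count_1_single_penultimate[of a k] unfolding eqs by (simp add: k_def a_def)
  have r1: "real (peak_count {1, k - a} (k - 1)) =
    ((real c + 1) * real ((b + c + 3) choose (c + 3)) + (real c + 2) * real ((b + c + 3) choose (c + 2))
      - (real b + real c + 3)) * e"
    using peak_count_1_single[of "c + 3" "b + c + 5"] unfolding ka by (simp add: e_def add_ac)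
  have r2: "real (peak_count {1, a} (k - 1)) =
    ((real b + 1) * real ((b + c + 3) choose (b + 3)) + (real b + 2) * real ((b + c + 3) choose (b + 2))
      - (real b + real c + 3)) * e"
    using peak_count_1_single[of a "b + c + 5"] unfolding ka by (simp add: e_def a_def add_ac)
  have r3: "real (peak_count {1} a) * real (peak_count {1} (k - a)) =
      (real b + 1) * (real c + 1) * e"
    using peak_count_1[of a] peak_count_1[of "c + 3"] unfolding ka
    by (simp add: e_def a_def power_add add_ac)
  have cnt: "real (peak_count {1, m - 1, n - 2} n) =
      ((real b + 1) * (real c + 1) * real (k choose a) + real k *
        ((real c + 1) * real ((b + c + 3) choose (c + 3)) + (real c + 2) * real ((b + c + 3) choose (c + 2))
        + (real b + 1) * real ((b + c + 3) choose (b + 3)) + (real b + 2) * real ((b + c + 3) choose (b + 2))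
        - 2 * (real b + real c + 3))) * e"
    unfolding r0 of_nat_add[where ?'a = real] of_nat_mult r1 r2 r3 by (simp add: algebra_simps)
  \<comment> \<open>\<open>e\<close> is \<open>2 ^ (n - 5)\<close>, the power common to all three
    terms; the missing factor 2 explains the 2 in the formula.\<close>
  have "(2::real) ^ (n - 4) = 2 * e" by (simp add: c e_def power_add)
  then have "2 * peak_p m n = real (peak_count {1, m - 1, n - 2} n) / e"
    using assms by (simp add: peak_p_eq_peak_count)
  also have "\<dots> = (real b + 1) * (real c + 1) * real (k choose a) + real k *
        ((real c + 1) * real ((b + c + 3) choose (c + 3)) + (real c + 2) * real ((b + c + 3) choose (c + 2))
        + (real b + 1) * real ((b + c + 3) choose (b + 3)) + (real b + 2) * real ((b + c + 3) choose (b + 2))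
        - 2 * (real b + real c + 3))"
    unfolding cnt by (simp add: e_def)
  \<comment> \<open>The reversed count has columns \<open>c + 3\<close> and \<open>c + 2\<close>;
    symmetry of the row turns them into \<open>m - 4\<close> and \<open>m - 3\<close>.\<close>
  also have "(b + c + 3) choose (c + 3) = (b + c + 3) choose b"
    using binomial_symmetric[of b "b + c + 3"] by simp
  also have "(b + c + 3) choose (c + 2) = (b + c + 3) choose (b + 1)"
    using binomial_symmetric[of "b + 1" "b + c + 3"] by simp
  finally show ?thesis by (simp add: b c k_def a_def algebra_simps)
qed

text \<open>The four entries of row \<open>n - 4\<close> are in known ratios, and their Pascal
  combination is \<open>(n - 1) choose (m - 1)\<close>, so all collapse to multiples of it. The
  factor \<open>n - 2\<close> clears the remaining denominator.\<close>

lemma peak_p_closed_form: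
  assumes "4 \<le> m" "m \<le> n - 3"
  shows "(real n - 2) * (2 * peak_p m n) =
    real ((n - 1) choose (m - 1)) *
      (2 * real n * ((real m - 1) * (real n - real m)) - 4 * (real n - 2)\<^sup>2)
    - 2 * (real n - 1) * (real n - 2) * (real n - 4)"
proof -
  obtain b where b: "m = b + 4" using assms by (intro that[of "m - 4"]) auto
  obtain c where c: "n = b + c + 7" using assms b by (intro that[of "n - b - 7"]) auto
  define x y z w where "x = real ((b + c + 3) choose (b + 3))"
    and "y = real ((b + c + 3) choose (b + 2))"
    and "z = real ((b + c + 3) choose (b + 1))"
    and "w = real ((b + c + 3) choose b)"
  have absorb: "real (Suc i) * real (N choose Suc i) = (real N - real i) * real (N choose i)"
    if "i \<le> N" for i N
  proof -
    have "Suc i * (N choose Suc i) = (N - i) * (N choose i)"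
      using binomial_absorb_comp[of N i] binomial_absorption[of i N] by simp
    then show ?thesis using that by (metis of_nat_diff of_nat_mult)
  qed
  have xy: "(real b + 3) * x = (real c + 1) * y" and yz: "(real b + 2) * y = (real c + 2) * z"
    and zw: "(real b + 1) * z = (real c + 3) * w"
    using absorb[of "b + 2" "b + c + 3"] absorb[of "b + 1" "b + c + 3"] absorb[of b "b + c + 3"]
    by (simp_all add: x_def y_def z_def w_def algebra_simps numeral_eq_Suc)
  \<comment> \<open>Pascal's rule applied three times.\<close>
  have "real ((n - 1) choose (m - 1)) = x + 3 * y + 3 * z + w"
    by (simp add: x_def y_def z_def w_def b c numeral_eq_Suc)
  moreover have "real ((n - 4) choose (m - 1)) = x" "real ((n - 4) choose (m - 2)) = y"
    "real ((n - 4) choose (m - 3)) = z" "real ((n - 4) choose (m - 4)) = w"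
    by (simp_all add: x_def y_def z_def w_def b c numeral_eq_Suc)
  ultimately show ?thesis
    unfolding two_peak_p_eq[OF assms] using xy yz zw
    by (simp add: b c) algebra
qed

text \<open>Strictness comes from the binomial coefficient, so \<open>?q\<close> need only be
  nondecreasing and positive at \<open>i\<close>.\<close>

lemma peak_p_strict_mono:
  assumes "4 \<le> i" "i < j" "2 * j \<le> n + 1" "7 \<le> n"
  shows "peak_p i n < peak_p j n"
proof -
  let ?w = "\<lambda>m. (real m - 1) * (real n - real m)"
  let ?q = "\<lambda>m. 2 * real n * ?w m - 4 * (real n - 2)\<^sup>2"
  \<comment> \<open>\<open>2 * j \<le> n + 1\<close> says that \<open>j - 1\<close> is at most half
    of \<open>n - 1\<close>.\<close>
  have C: "(n - 1) choose (i - 1) < (n - 1) choose (j - 1)"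
    using assms by (intro binomial_strict_mono) auto
  \<comment> \<open>This product is \<open>?w j - ?w i\<close>.\<close>
  have "0 \<le> (real j - real i) * (real n + 1 - real i - real j)"
    using assms by (intro mult_nonneg_nonneg) auto
  then have "?w i \<le> ?w j" by (simp add: algebra_simps)
  then have qm: "?q i \<le> ?q j" using mult_left_mono[of "?w i" "?w j" "2 * real n"] by simp
  \<comment> \<open>This product is \<open>?w i - ?w 4\<close>; positivity of \<open>?q\<close> is
    thereby reduced to \<open>m = 4\<close>, where \<open>7 \<le> n\<close> suffices.\<close>
  have "0 \<le> (real i - 4) * (real n - 3 - real i)"
    using assms by (intro mult_nonneg_nonneg) auto
  then have "3 * (real n - 4) \<le> ?w i" by (simp add: algebra_simps)
  then have "2 * real n * (3 * (real n - 4)) \<le> 2 * real n * ?w i" by (intro mult_left_mono) auto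
  moreover have "0 < 2 * real n * (3 * (real n - 4)) - 4 * (real n - 2)\<^sup>2"
  proof -
    have n: "7 \<le> real n" using assms by simp
    then have "0 \<le> (real n - 7) * real n" by (intro mult_nonneg_nonneg) auto
    moreover have "2 * real n * (3 * (real n - 4)) - 4 * (real n - 2)\<^sup>2 =
        2 * ((real n - 7) * real n) + (6 * real n - 16)"
      by (simp add: algebra_simps power2_eq_square)
    ultimately show ?thesis using n by linarith
  qed
  ultimately have qp: "0 < ?q i" by linarith
  have "real ((n - 1) choose (i - 1)) * ?q i < real ((n - 1) choose (j - 1)) * ?q i"
    using C qp by (intro mult_strict_right_mono) auto
  also have "\<dots> \<le> real ((n - 1) choose (j - 1)) * ?q j"
    using qm by (intro mult_left_mono) auto
  finally have "(real n - 2) * (2 * peak_p i n) < (real n - 2) * (2 * peak_p j n)"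
    using assms peak_p_closed_form[of i n] peak_p_closed_form[of j n] by simp
  then show ?thesis using assms by simp
qed

text \<open>Growth up to the middle is reflected by the symmetry into decay beyond it.\<close>

lemma unimodal_on_symmetric:
  fixes f :: "nat \<Rightarrow> real"
  assumes "7 \<le> n"
    and sym: "\<And>m. m \<in> {4..n - 3} \<Longrightarrow> f (n + 1 - m) = f m"
    and mono: "\<And>i j. 4 \<le> i \<Longrightarrow> i < j \<Longrightarrow> 2 * j \<le> n + 1 \<Longrightarrow> f i < f j"
  shows "unimodal_on {4..n - 3} f"
    and "{m \<in> {4..n - 3}. \<forall>k\<in>{4..n - 3}. f k \<le> f m} = {(n + 1) div 2, (n + 2) div 2}"
proof -
  \<comment> \<open>\<open>?k\<close> and \<open>(n + 2) div 2\<close> are the middle indices,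
    exchanged by \<open>m \<mapsto> n + 1 - m\<close> and equal for odd \<open>n\<close>.\<close>
  let ?A = "{4..n - 3}" and ?k = "(n + 1) div 2"
  have k: "?k \<in> ?A" "(n + 2) div 2 \<in> ?A" using assms(1) by auto
  have le: "f i \<le> f j" if "i \<in> ?A" "i \<le> j" "j \<le> ?k" for i j
  proof (cases "i = j")
    case False
    then show ?thesis using mono[of i j] that by force
  qed simp
  \<comment> \<open>For even \<open>n\<close> the reflection of \<open>?k\<close> is
    \<open>?k + 1\<close>, out of reach of \<open>le\<close>, so \<open>i = ?k\<close> is a separate
    case.\<close>
  have ge: "f j \<le> f i" if "i \<in> ?A" "j \<in> ?A" "?k \<le> i" "i \<le> j" for i j
  proof (cases "i = ?k")
    case False
    then have "f (n + 1 - j) \<le> f (n + 1 - i)" using that by (intro le) auto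
    then show ?thesis using that sym by simp
  next
    case True
    show ?thesis
    proof (cases "j = ?k")
      case False
      then have "f (n + 1 - j) \<le> f i" using that True by (intro le) auto
      then show ?thesis using that sym by simp
    qed (use True in simp)
  qed
  show "unimodal_on ?A f" unfolding unimodal_on_def using k le ge by blast
  have mid: "f ((n + 2) div 2) = f ?k"
  proof -
    have "n + 1 - (n + 2) div 2 = ?k" by presburger
    then show ?thesis using sym[OF k(2)] by simp
  qed
  have max: "f m \<le> f ?k" if "m \<in> ?A" for m
    using le[of m ?k] ge[of ?k m] that k by (cases "m \<le> ?k") auto
  have strict: "f m < f ?k" if "m \<in> ?A" "m \<noteq> ?k" "m \<noteq> (n + 2) div 2" for m
  proof (cases "m < ?k")
    case True
    then show ?thesis using mono[of m ?k] that by simp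
  next
    case False
    \<comment> \<open>As \<open>m\<close> exceeds \<open>?k\<close> and is not the other middle
      index, its reflection lies strictly below \<open>?k\<close>.\<close>
    then have "f (n + 1 - m) < f ?k" using mono[of "n + 1 - m" ?k] that by force
    then show ?thesis using sym that by simp
  qed
  show "{m \<in> ?A. \<forall>k\<in>?A. f k \<le> f m} = {?k, (n + 2) div 2}" (is "?L = ?R")
  proof
    show "?L \<subseteq> ?R" using strict k(1) by (fastforce simp: not_le[symmetric])
    show "?R \<subseteq> ?L" using k max mid by auto
  qed
qed

theorem theorem4p3:
  fixes n :: nat
  assumes "7 \<le> n"
  shows "(\<forall>m. 4 \<le> m \<and> m \<le> n - 3 \<longrightarrow>
            2 * peak_p m n =
              (real m - 3) * (real n - real m - 2) * real ((n - 1) choose (m - 1)) +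
              (real n - 1) *
                ((real m - 3) * real ((n - 4) choose (m - 1)) +
                 (real m - 2) * real ((n - 4) choose (m - 2)) +
                 (real n - real m - 1) * real ((n - 4) choose (m - 3)) +
                 (real n - real m - 2) * real ((n - 4) choose (m - 4)) -
                 2 * real ((n - 4) choose 1))) \<and>
         (\<forall>m. 4 \<le> m \<and> m \<le> n - 3 \<longrightarrow> peak_p m n = peak_p (n + 1 - m) n) \<and>
         unimodal_on {4..n - 3} (\<lambda>m. peak_p m n) \<and>
         {m \<in> {4..n - 3}. \<forall>k\<in>{4..n - 3}. peak_p k n \<le> peak_p m n} =
           {nat \<lfloor>(real n + 1) / 2\<rfloor>, nat \<lceil>(real n + 1) / 2\<rceil>}"
proof -
  have floor: "nat \<lfloor>(real n + 1) / 2\<rfloor> = (n + 1) div 2"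
    using floor_divide_of_nat_eq[of "n + 1" 2, where ?'a = real] by (simp add: add.commute)
  \<comment> \<open>Rounding half of \<open>n + 1\<close> up is rounding half of
    \<open>n + 2\<close> down.\<close>
  have "\<lceil>(real n + 1) / 2\<rceil> = int ((n + 2) div 2)"
  proof (rule ceiling_unique)
    have "2 * ((n + 2) div 2) \<le> n + 2" "n + 1 \<le> 2 * ((n + 2) div 2)" by presburger+
    then have "2 * real ((n + 2) div 2) \<le> real n + 2" "real n + 1 \<le> 2 * real ((n + 2) div 2)"
      by linarith+
    then show "real_of_int (int ((n + 2) div 2)) - 1 < (real n + 1) / 2"
      "(real n + 1) / 2 \<le> real_of_int (int ((n + 2) div 2))" by simp_all
  qed
  then have ceiling: "nat \<lceil>(real n + 1) / 2\<rceil> = (n + 2) div 2" by simp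
  have "peak_p (n + 1 - m) n = peak_p m n" if "m \<in> {4..n - 3}" for m
    using that by (intro peak_p_symmetric) auto
  note unimodal =
    unimodal_on_symmetric[of n "\<lambda>m. peak_p m n", OF assms this peak_p_strict_mono[OF _ _ _ assms]]
  show ?thesis
    unfolding floor ceiling
    by (intro conjI allI impI)
      (use two_peak_p_eq peak_p_symmetric[symmetric] unimodal in blast)+
qed

end
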